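(* Let $d\ge 2$ and let $M\subseteq\mathbb{R}^d$ be a min-max closed set which is either finite and nonempty, or Lebesgue measurable with positive finite Lebesgue measure. Let $Q$ be the uniform distribution over $M$, and let $\alpha:\mathbb{R}^d\to[0,\infty)$ be its weight function (in the finite case: $\alpha(x)=1/|M|$ for $x\in M$ and $\alpha(x)=0$ for $x\notin M$) or its density (in the other case: $\alpha(x)=c$ for $x\in M$ and $\alpha(x)=0$ for $x\notin M$, where $c>0$ is the reciprocal of the Lebesgue measure of $M$). Then $Q$ satisfies Constraint A: for all real numbers $x_{10}<x_{11},\ x_{20}<x_{21},\ \dots,\ x_{d0}<x_{d1}$ and every permutation $\pi$ of $\{1,\dots,d\}$, $$\sum_{a\in\{0,1\}^{d-2}}\Big(\alpha(x_{\pi(11a)})\,\alpha(x_{\pi(00\overline a)})-\alpha(x_{\pi(10a)})\,\alpha(x_{\pi(01\overline a)})\Big)\ge 0.$$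
   Context: A set $M\subseteq\mathbb{R}^d$ is min-max closed if for all $u,v\in M$ the coordinate-wise minimum $u\wedge v$ and coordinate-wise maximum $u\vee v$ are also in $M$. Given the numbers $x_{ij}$ ($1\le i\le d$, $j\in\{0,1\}$) and a binary string $b\in\{0,1\}^d$, $x_b:=(x_{1b_1},x_{2b_2},\dots,x_{db_d})\in\mathbb{R}^d$. For a binary string $b$ of any length, $\overline b$ is the complementary string, obtained by replacing each entry $b_i$ with $1-b_i$. For $a\in\{0,1\}^{d-2}$, $11a$, $00\overline a$, $10a$, $01\overline a$ denote the length-$d$ strings obtained by concatenation (for $d=2$, $a$ is the empty string). For a permutation $\pi$ of $\{1,\dots,d\}$ and $b\in\{0,1\}^d$, $\pi(b)$ is the string obtained by permuting the positions of the entries of $b$ according to $\pi$ (the same permutation is applied to all four strings). *)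

theory Defs
  imports "HOL-Analysis.Analysis" "HOL-Combinatorics.Combinatorics"
begin

text \<open>The dimension is \<open>d = CARD('n)\<close>. Since an index type \<open>'n\<close> carries no
  numbering of its own, the coordinates are numbered by an explicit bijection
  \<open>idx\<close> onto \<open>{..<d}\<close> (positions counted from 0). A binary string is a
  \<open>bool list\<close>, with \<open>False\<close> for 0 and \<open>True\<close> for 1.\<close>

definition min_max_closed :: "(real ^ 'n) set \<Rightarrow> bool" where
  "min_max_closed M \<longleftrightarrow>
     (\<forall>u\<in>M. \<forall>v\<in>M. (\<chi> i. min (u $ i) (v $ i)) \<in> M \<and> (\<chi> i. max (u $ i) (v $ i)) \<in> M)"

definition grid_point :: "('n \<Rightarrow> nat) \<Rightarrow> ('n \<Rightarrow> bool \<Rightarrow> real) \<Rightarrow> bool list \<Rightarrow> real ^ 'n" where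
  "grid_point idx x b = (\<chi> i. x i (b ! idx i))"

definition complement_string :: "bool list \<Rightarrow> bool list" where
  "complement_string b = map Not b"

text \<open>\<open>permute_list \<pi> b\<close> has \<open>b ! \<pi> k\<close> at position \<open>k\<close>. Using the inverse
  permutation instead would give the same constraint, as all \<open>\<pi>\<close> are considered.\<close>

definition constraint_A :: "('n::finite \<Rightarrow> nat) \<Rightarrow> (real ^ 'n \<Rightarrow> real) \<Rightarrow> bool" where
  "constraint_A idx \<alpha> \<longleftrightarrow>
     (\<forall>x :: 'n \<Rightarrow> bool \<Rightarrow> real. \<forall>\<pi>.
        (\<forall>i. x i False < x i True) \<longrightarrow> \<pi> permutes {..<CARD('n)} \<longrightarrow>
        (\<Sum>a | length a = CARD('n) - 2.
            \<alpha> (grid_point idx x (permute_list \<pi> ([True, True] @ a)))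
              * \<alpha> (grid_point idx x (permute_list \<pi> ([False, False] @ complement_string a)))
          - \<alpha> (grid_point idx x (permute_list \<pi> ([True, False] @ a)))
              * \<alpha> (grid_point idx x (permute_list \<pi> ([False, True] @ complement_string a))))
        \<ge> 0)"

definition uniform_weight :: "'a set \<Rightarrow> 'a \<Rightarrow> real" where
  "uniform_weight M x = (if x \<in> M then 1 / real (card M) else 0)"

definition uniform_density :: "'a::euclidean_space set \<Rightarrow> 'a \<Rightarrow> real" where
  "uniform_density M x = (if x \<in> M then 1 / measure lebesgue M else 0)"

lemma finite_strings: "finite {a :: bool list. length a = n}"
  using finite_lists_length_eq[of "UNIV :: bool set" n] by simp

text \<open>The functions above are the weight function and a density of the respective
  uniform distribution.\<close>

lemma uniform_measure_eq_density_weight: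
  assumes "finite M" "M \<noteq> {}"
  shows "uniform_measure (count_space UNIV) M = density (count_space UNIV) (uniform_weight M)"
  unfolding uniform_measure_def
proof (rule density_cong)
  have c: "card M > 0" using assms by (simp add: card_gt_0_iff)
  then show "AE x in count_space UNIV.
      indicator M x / emeasure (count_space UNIV) M = ennreal (uniform_weight M x)"
    using assms by (auto simp: uniform_weight_def divide_ennreal[symmetric]
        ennreal_of_nat_eq_real_of_nat indicator_def)
qed auto

lemma uniform_measure_eq_density_density:
  assumes "M \<in> sets lebesgue" "0 < emeasure lebesgue M" "emeasure lebesgue M < \<infinity>"
  shows "uniform_measure lebesgue M = density lebesgue (uniform_density M)"
  unfolding uniform_measure_def
proof (rule density_cong)
  have e: "emeasure lebesgue M = ennreal (measure lebesgue M)"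
    using assms by (simp add: emeasure_eq_ennreal_measure)
  have m: "measure lebesgue M > 0"
    using assms e by (metis ennreal_0 not_less_iff_gr_or_eq zero_less_measure_iff)
  have f: "uniform_density M = (\<lambda>x. indicator M x / measure lebesgue M)"
    by (auto simp: uniform_density_def fun_eq_iff)
  show "(\<lambda>x. ennreal (uniform_density M x)) \<in> borel_measurable lebesgue"
    unfolding f using assms by measurable
  show "(\<lambda>x. indicator M x / emeasure lebesgue M) \<in> borel_measurable lebesgue"
    using assms by measurable
  show "AE x in lebesgue. indicator M x / emeasure lebesgue M = ennreal (uniform_density M x)"
    unfolding e using m
    by (auto simp: uniform_density_def divide_ennreal[symmetric] indicator_def)
qed

end

theory Submission
  imports Defs
begin

text \<open>
  Since \<open>\<alpha>\<close> is a nonnegative constant \<open>c\<close> on \<open>M\<close> and zero elsewhere, the sum in Constraint A is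
  \<open>c\<^sup>2\<close> times a difference of two cardinalities. The grid \<open>{x\<^sub>b}\<close> is a copy of the Boolean lattice
  \<open>{0,1}\<^sup>d\<close> in which coordinate-wise minimum and maximum are conjunction and disjunction, so the strings
  whose grid points lie in \<open>M\<close> form a sublattice \<open>L\<close>; permuting positions does not affect this.

  The strings \<open>b\<close> with both \<open>b\<close> and \<open>\<not>b\<close> in \<open>L\<close> are closed under complement and the lattice
  operations, hence under exclusive or: they are a subgroup of \<open>(\<int>/2)\<^sup>d\<close> (when there is one at
  all). Whether the first two entries differ is a homomorphism from this subgroup to \<open>\<int>/2\<close>, so the
  strings with different first entries are either absent or form a coset of its kernel. In both cases
  there are at most as many of them as there are strings with equal first entries, which is the
  required inequality. Translation by one fixed string \<open>10w\<close> of the first kind supplies the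
  injection; it is carried out in \<open>card_unequal_le_card_equal\<close>.
\<close>

lemma map2_eq_inject:
  assumes "length u = length w" "length v = length w" "map2 (=) w u = map2 (=) w v"
  shows "u = (v :: bool list)"
proof (rule nth_equalityI)
  show "length u = length v" using assms by simp
  fix i assume i: "i < length u"
  have "map2 (=) w u ! i = map2 (=) w v ! i" using assms(3) by simp
  then show "u ! i = v ! i" using i assms(1,2) by auto
qed

text \<open>
  If \<open>10w\<close> and \<open>10a\<close> are in the sublattice together with their complements, then so are the
  exclusive or of the two, and the negation of that. The negation is \<open>11\<close> followed by the
  equivalence of \<open>w\<close> and \<open>a\<close>, which is why the injection is \<open>map2 (=) w\<close>. Both memberships are the
  two normal forms of the equivalence,
  \<open>(p \<and> q) \<or> (\<not>p \<and> \<not>q)\<close>, and of its negation, \<open>(p \<or> q) \<and> (\<not>p \<or> \<not>q)\<close>.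
\<close>

lemma card_unequal_le_card_equal:
  fixes S :: "bool list \<Rightarrow> bool"
  assumes inf: "\<And>u v. \<lbrakk>length u = n + 2; length v = n + 2; S u; S v\<rbrakk> \<Longrightarrow> S (map2 (\<and>) u v)"
    and sup: "\<And>u v. \<lbrakk>length u = n + 2; length v = n + 2; S u; S v\<rbrakk> \<Longrightarrow> S (map2 (\<or>) u v)"
  shows "card {a. length a = n \<and> S ([True, False] @ a) \<and> S ([False, True] @ complement_string a)}
       \<le> card {a. length a = n \<and> S ([True, True] @ a) \<and> S ([False, False] @ complement_string a)}"
    (is "card ?U \<le> card ?E")
proof (cases "?U = {}")
  case True
  then show ?thesis by (simp only: card.empty le0)
next
  case False
  then obtain w where w: "length w = n" "S ([True, False] @ w)"
      "S ([False, True] @ complement_string w)"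
    by blast
  have "finite ?E"
    by (rule finite_subset[OF _ finite_strings[of n]]) blast
  moreover have "inj_on (map2 (=) w) ?U"
    by (rule inj_onI) (use w(1) map2_eq_inject in auto)
  moreover have "map2 (=) w ` ?U \<subseteq> ?E"
  proof clarify
    fix a assume a: "n = length a" "S ([True, False] @ a)" "S ([False, True] @ complement_string a)"
    have len: "length ([True, False] @ w) = n + 2" "length ([True, False] @ a) = n + 2"
      "length ([False, True] @ complement_string w) = n + 2"
      "length ([False, True] @ complement_string a) = n + 2"
      using w(1) a(1) by (simp_all add: complement_string_def)
    have "S (map2 (\<or>) (map2 (\<and>) ([True, False] @ w) ([True, False] @ a))
        (map2 (\<and>) ([False, True] @ complement_string w) ([False, True] @ complement_string a)))"
      using len w a by (intro sup inf) auto
    also have "map2 (\<or>) (map2 (\<and>) ([True, False] @ w) ([True, False] @ a))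
        (map2 (\<and>) ([False, True] @ complement_string w) ([False, True] @ complement_string a))
      = [True, True] @ map2 (=) w a"
      using w(1) a(1) by (auto simp: complement_string_def intro!: nth_equalityI)
    finally have 1: "S ([True, True] @ map2 (=) w a)" .
    have "S (map2 (\<and>) (map2 (\<or>) ([True, False] @ w) ([True, False] @ a))
        (map2 (\<or>) ([False, True] @ complement_string w) ([False, True] @ complement_string a)))"
      using len w a by (intro sup inf) auto
    also have "map2 (\<and>) (map2 (\<or>) ([True, False] @ w) ([True, False] @ a))
        (map2 (\<or>) ([False, True] @ complement_string w) ([False, True] @ complement_string a))
      = [False, False] @ complement_string (map2 (=) w a)"
      using w(1) a(1) by (auto simp: complement_string_def intro!: nth_equalityI)
    finally have 2: "S ([False, False] @ complement_string (map2 (=) w a))" .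
    show "length (map2 (=) w a) = length a \<and> S ([True, True] @ map2 (=) w a)
        \<and> S ([False, False] @ complement_string (map2 (=) w a))"
      using 1 2 w(1) a(1) by simp
  qed
  ultimately show ?thesis by (metis (lifting) card_inj_on_le)
qed

lemma grid_point_permute_map2:
  fixes idx :: "'n::finite \<Rightarrow> nat"
  assumes "\<And>i. idx i < CARD('n)" "\<And>i. x i False < x i True" "\<pi> permutes {..<CARD('n)}"
    and "length u = CARD('n)" "length v = CARD('n)"
  shows "grid_point idx x (permute_list \<pi> (map2 (\<and>) u v))
       = (\<chi> i. min (grid_point idx x (permute_list \<pi> u) $ i) (grid_point idx x (permute_list \<pi> v) $ i))"
    and "grid_point idx x (permute_list \<pi> (map2 (\<or>) u v))
       = (\<chi> i. max (grid_point idx x (permute_list \<pi> u) $ i) (grid_point idx x (permute_list \<pi> v) $ i))"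
proof -
  have le: "x i False \<le> x i True" for i using assms(2) by (rule less_imp_le)
  have p: "\<pi> (idx i) < CARD('n)" for i
    using permutes_in_image[OF assms(3)] assms(1) by auto
  have m: "x i (s \<and> t) = min (x i s) (x i t)" "x i (s \<or> t) = max (x i s) (x i t)" for i s t
    using le[of i] by (cases s; cases t; simp add: min_def max_def)+
  show "grid_point idx x (permute_list \<pi> (map2 (\<and>) u v))
       = (\<chi> i. min (grid_point idx x (permute_list \<pi> u) $ i) (grid_point idx x (permute_list \<pi> v) $ i))"
    and "grid_point idx x (permute_list \<pi> (map2 (\<or>) u v))
       = (\<chi> i. max (grid_point idx x (permute_list \<pi> u) $ i) (grid_point idx x (permute_list \<pi> v) $ i))"
    using assms p by (simp_all add: grid_point_def vec_eq_iff permute_list_nth m)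
qed

text \<open>
  The finite and the Lebesgue case differ only in the constant \<open>c\<close>, which enters squared.
\<close>

lemma constraint_A_constant_on_min_max_closed:
  fixes M :: "(real ^ 'n) set" and idx :: "'n \<Rightarrow> nat"
  assumes d: "CARD('n) \<ge> 2" and idx: "\<And>i. idx i < CARD('n)" and M: "min_max_closed M"
  shows "constraint_A idx (\<lambda>y. if y \<in> M then c else 0)"
  unfolding constraint_A_def
proof (intro allI impI)
  fix x :: "'n \<Rightarrow> bool \<Rightarrow> real" and \<pi>
  assume x: "\<forall>i. x i False < x i True" and \<pi>: "\<pi> permutes {..<CARD('n)}"
  define n where "n = CARD('n) - 2"
  have n: "CARD('n) = n + 2" using d by (simp add: n_def)
  define S where "S b \<longleftrightarrow> grid_point idx x (permute_list \<pi> b) \<in> M" for b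
  let ?E = "{a. length a = n \<and> S ([True, True] @ a) \<and> S ([False, False] @ complement_string a)}"
  let ?U = "{a. length a = n \<and> S ([True, False] @ a) \<and> S ([False, True] @ complement_string a)}"
  have "card ?U \<le> card ?E"
  proof (rule card_unequal_le_card_equal)
    fix u v assume uv: "length u = n + 2" "length v = n + 2" "S u" "S v"
    then have len: "length u = CARD('n)" "length v = CARD('n)" by (simp_all add: n)
    show "S (map2 (\<and>) u v)" "S (map2 (\<or>) u v)"
      using M uv(3,4) unfolding S_def min_max_closed_def
        grid_point_permute_map2[where x = x, OF idx spec[OF x] \<pi> len]
      by blast+
  qed
  have sq: "(if p then c else 0) * (if q then c else 0) = c\<^sup>2 * of_bool (p \<and> q)" for p q
    by (simp add: power2_eq_square)
  have count: "(\<Sum>a | length a = n. of_bool (P a)) = real (card {a. length a = n \<and> P a})"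
    for P :: "bool list \<Rightarrow> bool"
    using finite_strings[of n] by (simp add: of_bool_def sum.If_cases Collect_conj_eq)
  have "(\<Sum>a | length a = n.
        c\<^sup>2 * of_bool (S ([True, True] @ a) \<and> S ([False, False] @ complement_string a))
      - c\<^sup>2 * of_bool (S ([True, False] @ a) \<and> S ([False, True] @ complement_string a)))
      = c\<^sup>2 * (real (card ?E) - real (card ?U))"
    unfolding sum_subtractf sum_distrib_left[symmetric] count by (simp only: right_diff_distrib)
  also have "\<dots> \<ge> 0"
    using \<open>card ?U \<le> card ?E\<close> by (intro mult_nonneg_nonneg) simp_all
  finally show "(\<Sum>a | length a = CARD('n) - 2.
        (if grid_point idx x (permute_list \<pi> ([True, True] @ a)) \<in> M then c else 0)
          * (if grid_point idx x (permute_list \<pi> ([False, False] @ complement_string a)) \<in> M then c else 0)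
      - (if grid_point idx x (permute_list \<pi> ([True, False] @ a)) \<in> M then c else 0)
          * (if grid_point idx x (permute_list \<pi> ([False, True] @ complement_string a)) \<in> M then c else 0))
      \<ge> 0"
    unfolding sq S_def n_def .
qed

theorem proposition8:
  fixes M :: "(real ^ 'n) set"
    and Q :: "(real ^ 'n) measure"
    and \<alpha> :: "real ^ 'n \<Rightarrow> real"
    and idx :: "'n \<Rightarrow> nat"
  assumes "CARD('n) \<ge> 2"
    and "bij_betw idx UNIV {..<CARD('n)}"
    and "min_max_closed M"
    and "(finite M \<and> M \<noteq> {}
            \<and> Q = uniform_measure (count_space UNIV) M \<and> \<alpha> = uniform_weight M)
       \<or> (M \<in> sets lebesgue \<and> 0 < emeasure lebesgue M \<and> emeasure lebesgue M < \<infinity>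
            \<and> Q = uniform_measure lebesgue M \<and> \<alpha> = uniform_density M)"
  shows "constraint_A idx \<alpha>"
proof -
  obtain c where "\<alpha> = (\<lambda>y. if y \<in> M then c else 0)"
    using assms(4) unfolding uniform_weight_def uniform_density_def by blast
  moreover have "idx i < CARD('n)" for i
    using bij_betwE[OF assms(2)] by simp
  ultimately show ?thesis
    using constraint_A_constant_on_min_max_closed[OF assms(1) _ assms(3)] by blast
qed

end
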